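(* Let $N\in\mathbb{N}$ and let $(\mathbb{Z}^N,\omega_0,\mu)$ be the $N$-dimensional integer lattice. Let $f:[0,\infty)\to[0,\infty)$ be a locally Lipschitz, convex function with $f(0)=0$, $f(u)>0$ for all $u>0$, $\int_1^\infty \frac{du}{f(u)}<\infty$ and $\lim_{u\to\infty}\frac{f(u)}{u}=+\infty$. Let $u_0:\mathbb{Z}^N\to[0,+\infty)$ be bounded with $u_0\not\equiv0$, and let $u$ be a solution of $u_t-\Delta u=f(u)$ in $\mathbb{Z}^N\times(0,T)$, $u=u_0$ in $\mathbb{Z}^N\times\{0\}$, with maximal time of existence $T\in(0,+\infty]$. Set $s_0(\lambda):=\inf\{v>0:\ f(v)/v>\lambda\}$ for $\lambda>0$ and $\theta(\sigma):=\sum_{m\in\mathbb{Z}}e^{-\pi m^2\sigma}$ for $\sigma>0$. If, for some $k>0$ and some $\lambda\ge1-e^{-k}$, $$\frac{1}{2N}\Bigl[\theta\Bigl(\frac{k}{\pi}\Bigr)\Bigr]^{-N}\sum_{x\in\mathbb{Z}^N}e^{-k|x|^2}\,u_0(x)\,\mu(x)>s_0(\lambda),$$ then $u$ blows up in finite time. In particular, if $f(u)=u^p$ with $p>1$, the same conclusion holds if the previous condition is replaced by the following one: for some $k>0$, $$\sum_{x\in\mathbb{Z}^N}e^{-k|x|^2}\,u_0(x)\,\mu(x)>(2N)^{\frac{p}{p-1}}\Bigl[\theta\Bigl(\frac{k}{\pi}\Bigr)\Bigr]^{N}k^{\frac1{p-1}}.$$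
   Context: $\mathbb{N}=\{1,2,\dots\}$. The $N$-dimensional integer lattice $(\mathbb{Z}^N,\omega_0,\mu)$ is the weighted graph with vertex set $\mathbb{Z}^N$, where $x\sim y$ if and only if $x$ and $y$ differ by $\pm1$ in exactly one coordinate and agree in all others, edge weight $\omega_0(x,y)=1$ if $x\sim y$ and $0$ otherwise, and node measure $\mu(x)=2N$ for every $x$. $|x|:=\bigl(\sum_{i=1}^Nx_i^2\bigr)^{1/2}$. Laplacian: $\Delta g(x):=\frac1{\mu(x)}\sum_{y}\omega_0(x,y)[g(y)-g(x)]=\frac1{2N}\sum_{y\sim x}[g(y)-g(x)]$, acting on the space variable of $u(x,t)$. $\ell^\infty(\mathbb{Z}^N)$ is the set of bounded functions on $\mathbb{Z}^N$, with the sup norm $\|\cdot\|_\infty$. Solution: a function $u:\mathbb{Z}^N\times[0,T)\to\mathbb{R}$ with $u(x,\cdot)\in C^1((0,T))\cap C^0([0,T))$ for all $x$, $u\in L^\infty(\mathbb{Z}^N\times[0,T'])$ for all $T'\in(0,T)$, $u\ge0$ in $\mathbb{Z}^N\times(0,T)$, and satisfying the equation and the initial condition pointwise. The solution is considered up to its maximal time of existence $T\in(0,+\infty]$, and by convention exactly one of two alternatives holds: either $T=+\infty$ and $u(\cdot,t)\in\ell^\infty(\mathbb{Z}^N)$ for all $t>0$ ($u$ is global), or $T<+\infty$ and $\lim_{t\to T^-}\|u(\cdot,t)\|_\infty=+\infty$. "$u$ blows up in finite time" means that the maximal time of existence is finite, $0<T<+\infty$, with $u(\cdot,t)\in\ell^\infty(\mathbb{Z}^N)$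 for all $t\in(0,T)$ and $\lim_{t\to T^-}\|u(\cdot,t)\|_\infty=+\infty$. *)

theory Defs
  imports "HOL-Analysis.Analysis"
begin

text \<open>
  The vertex set \<open>\<int>\<^sup>N\<close> is the type \<^typ>\<open>int ^ 'n\<close> with \<open>N = CARD('n)\<close>, so \<open>N \<ge> 1\<close> is automatic.
\<close>

definition lattice_adj :: "int ^ 'n \<Rightarrow> int ^ 'n \<Rightarrow> bool" where
  "lattice_adj x y \<longleftrightarrow> (\<exists>i. \<bar>x $ i - y $ i\<bar> = 1 \<and> (\<forall>j. j \<noteq> i \<longrightarrow> x $ j = y $ j))"

definition edge_weight :: "int ^ 'n \<Rightarrow> int ^ 'n \<Rightarrow> real" where
  "edge_weight x y = (if lattice_adj x y then 1 else 0)"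

definition node_measure :: "int ^ 'n \<Rightarrow> real" where
  "node_measure x = 2 * real CARD('n)"

definition euclid_norm :: "int ^ 'n \<Rightarrow> real" where
  "euclid_norm x = sqrt (\<Sum>i\<in>UNIV. (real_of_int (x $ i))\<^sup>2)"

text \<open>
  Each vertex has finitely many neighbours, so the following infinite sum has only
  finitely many nonzero terms; see \<open>lattice_laplacian_eq\<close> below.
\<close>

definition lattice_laplacian :: "(int ^ 'n \<Rightarrow> real) \<Rightarrow> int ^ 'n \<Rightarrow> real" where
  "lattice_laplacian g x = 1 / node_measure x * (\<Sum>\<^sub>\<infinity>y. edge_weight x y * (g y - g x))"

definition linf :: "(int ^ 'n \<Rightarrow> real) set" where
  "linf = {g. bounded (range g)}"

text \<open>Only meaningful for functions in \<^const>\<open>linf\<close>.\<close>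

definition sup_norm :: "(int ^ 'n \<Rightarrow> real) \<Rightarrow> real" where
  "sup_norm g = (SUP x. \<bar>g x\<bar>)"

text \<open>
  A function on \<open>\<int>\<^sup>N \<times> [0,T)\<close> is represented by a total function; only its values at times
  in \<open>[0,T)\<close> are constrained. Likewise \<open>f\<close> is only used on \<open>[0,\<infinity>)\<close>.
\<close>

definition is_solution ::
  "(real \<Rightarrow> real) \<Rightarrow> (int ^ 'n \<Rightarrow> real) \<Rightarrow> ereal \<Rightarrow> (int ^ 'n \<Rightarrow> real \<Rightarrow> real) \<Rightarrow> bool" where
  "is_solution f u0 T u \<longleftrightarrow>
     0 < T \<and>
     (\<forall>x. u x C1_differentiable_on {t. 0 < t \<and> ereal t < T}) \<and>
     (\<forall>x. continuous_on {t. 0 \<le> t \<and> ereal t < T} (u x)) \<and>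
     (\<forall>T'. 0 < T' \<and> ereal T' < T \<longrightarrow> bounded {u x t | x t. 0 \<le> t \<and> t \<le> T'}) \<and>
     (\<forall>x t. 0 < t \<and> ereal t < T \<longrightarrow> 0 \<le> u x t) \<and>
     (\<forall>x t. 0 < t \<and> ereal t < T \<longrightarrow>
        deriv (u x) t - lattice_laplacian (\<lambda>y. u y t) x = f (u x t)) \<and>
     (\<forall>x. u x 0 = u0 x)"

definition norm_explodes :: "ereal \<Rightarrow> (int ^ 'n \<Rightarrow> real \<Rightarrow> real) \<Rightarrow> bool" where
  "norm_explodes T u \<longleftrightarrow>
     filterlim (\<lambda>t. sup_norm (\<lambda>x. u x t)) at_top (at_left (real_of_ereal T))"

text \<open>
  By convention, \<open>T\<close> is the maximal time of existence of the solution \<open>u\<close> when \<open>u\<close> is global or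
  its sup norm tends to infinity at the finite time \<open>T\<close>. In the second case \<open>u\<close> has no extension
  to a solution beyond \<open>T\<close>, as solutions are bounded on every \<open>[0,T']\<close> inside their time interval.
\<close>

definition is_maximal_solution ::
  "(real \<Rightarrow> real) \<Rightarrow> (int ^ 'n \<Rightarrow> real) \<Rightarrow> ereal \<Rightarrow> (int ^ 'n \<Rightarrow> real \<Rightarrow> real) \<Rightarrow> bool" where
  "is_maximal_solution f u0 T u \<longleftrightarrow>
     is_solution f u0 T u \<and>
     (T = \<infinity> \<and> (\<forall>t>0. (\<lambda>x. u x t) \<in> linf) \<or> T < \<infinity> \<and> norm_explodes T u)"

text \<open>Here \<open>T\<close> is the maximal time of existence of \<open>u\<close>.\<close>

definition blows_up_in_finite_time :: "ereal \<Rightarrow> (int ^ 'n \<Rightarrow> real \<Rightarrow> real) \<Rightarrow> bool" where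
  "blows_up_in_finite_time T u \<longleftrightarrow>
     0 < T \<and> T < \<infinity> \<and>
     (\<forall>t. 0 < t \<and> ereal t < T \<longrightarrow> (\<lambda>x. u x t) \<in> linf) \<and>
     norm_explodes T u"

text \<open>
  \<^const>\<open>local_lipschitz\<close> is stated for time-dependent functions; the time argument is a dummy here.
\<close>

definition admissible_reaction :: "(real \<Rightarrow> real) \<Rightarrow> bool" where
  "admissible_reaction f \<longleftrightarrow>
     (\<forall>v\<ge>0. 0 \<le> f v) \<and>
     local_lipschitz (UNIV :: real set) {0..} (\<lambda>_. f) \<and>
     convex_on {0..} f \<and>
     f 0 = 0 \<and>
     (\<forall>v>0. 0 < f v) \<and>
     (\<integral>\<^sup>+v\<in>{1..}. ennreal (1 / f v) \<partial>lborel) < \<infinity> \<and>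
     filterlim (\<lambda>v. f v / v) at_top at_top"

definition s0 :: "(real \<Rightarrow> real) \<Rightarrow> real \<Rightarrow> real" where
  "s0 f l = Inf {v. 0 < v \<and> f v / v > l}"

definition theta :: "real \<Rightarrow> real" where
  "theta \<sigma> = (\<Sum>\<^sub>\<infinity>m\<in>(UNIV :: int set). exp (- pi * (real_of_int m)\<^sup>2 * \<sigma>))"

lemma finite_lattice_neighbours: "finite {y :: int ^ 'n. lattice_adj x y}"
proof -
  have "{y. lattice_adj x y} \<subseteq>
      (\<lambda>(i, d). \<chi> j. if j = i then x $ j + d else x $ j) ` (UNIV \<times> {-1, 1 :: int})"
  proof
    fix y assume "y \<in> {y. lattice_adj x y}"
    then obtain i where i: "\<bar>x $ i - y $ i\<bar> = 1" "\<forall>j. j \<noteq> i \<longrightarrow> x $ j = y $ j"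
      by (auto simp: lattice_adj_def)
    have "y = (\<lambda>(i, d). \<chi> j. if j = i then x $ j + d else x $ j) (i, y $ i - x $ i)"
      using i(2) by (auto simp: vec_eq_iff)
    moreover have "(i, y $ i - x $ i) \<in> UNIV \<times> {-1, 1}"
      using i(1) by auto
    ultimately show "y \<in> (\<lambda>(i, d). \<chi> j. if j = i then x $ j + d else x $ j) ` (UNIV \<times> {-1, 1 :: int})"
      by (rule image_eqI)
  qed
  then show ?thesis
    by (rule finite_subset) auto
qed

lemma lattice_laplacian_eq:
  fixes g :: "int ^ 'n \<Rightarrow> real"
  shows "lattice_laplacian g x = 1 / (2 * real CARD('n)) * (\<Sum>y | lattice_adj x y. g y - g x)"
proof -
  have "(\<Sum>\<^sub>\<infinity>y. edge_weight x y * (g y - g x)) = (\<Sum>\<^sub>\<infinity>y\<in>{y. lattice_adj x y}. g y - g x)"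
    by (rule infsum_cong_neutral) (auto simp: edge_weight_def)
  then show ?thesis
    by (simp add: lattice_laplacian_def node_measure_def finite_lattice_neighbours)
qed

end

theory Submission
  imports Defs
begin

text \<open>
  The proof is Kaplan's method: the solution is tested against the Gaussian weight
  \<open>w x = exp (- k * |x|\<^sup>2)\<close>, which satisfies the eigenvalue inequality
  \<open>\<Delta> w \<ge> - (1 - exp (- k)) * w\<close> for the lattice Laplacian: in each coordinate direction the two
  neighbours of \<open>x\<close> carry together at least \<open>2 * exp (- k) * w x\<close>, by the inequality \<open>s + 1 / s \<ge> 2\<close>. The total mass
  of \<open>w\<close> is \<open>theta (k / pi) ^ N\<close>, because \<open>w\<close> is a product of one-dimensional weights.

  Let \<open>\<Phi> t\<close> be the mean of \<open>u(\<sqdot>, t)\<close> with respect to \<open>w\<close>, normalised to total mass one. The node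
  measure is constant, so the left-hand side of the blow-up condition is \<open>\<Phi> 0\<close>. Summation
  by parts (\<open>gaussian_laplacian_ge\<close>) and Jensen's inequality (\<open>Jensen_weighted_infsum\<close>) give
  \<open>\<Phi>' \<ge> f \<Phi> - (1 - exp (- k)) * \<Phi>\<close> as long as the solution exists.

  Since \<open>f\<close> is convex with \<open>f 0 = 0\<close>, the quotient \<open>f v / v\<close> is nondecreasing. Hence \<open>\<Phi> 0 > s0 f l\<close> with
  \<open>l \<ge> 1 - exp (- k)\<close> means that the reaction beats the loss at time \<open>0\<close>. It then does so at all later
  times, by a fixed factor: \<open>\<Phi>' \<ge> c * f \<Phi>\<close> for some \<open>c > 0\<close>. As \<open>1 / f\<close> is integrable at
  infinity, Osgood's argument shows that \<open>\<Phi>\<close> cannot exist for all times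
  (\<open>no_global_supersolution_of_reaction_ode\<close>). So the solution is not global, and the convention on
  maximal solutions yields blow-up.

  For \<open>f v = v powr p\<close> the choice \<open>l = k\<close> is admissible, as \<open>1 - exp (- k) \<le> k\<close>. The threshold is then
  \<open>k powr (1 / (p - 1))\<close>, and the factor \<open>(2 * N) powr (p / (p - 1))\<close> in the condition is at least the
  factor \<open>2 * N\<close> that comes from the node measure.
\<close>

section \<open>Convex reaction terms\<close>

text \<open>
  The slope of the chord from the origin to the graph of \<open>f\<close> increases. This is the form in which
  convexity is used most: it says how the reaction compares with a linear loss.
\<close>

lemma convex_through_zero_ratio_mono:
  fixes f :: "real \<Rightarrow> real"
  assumes "convex_on {0..} f" "f 0 = 0" "0 < a" "a \<le> b"
  shows "f a / a \<le> f b / b"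
proof -
  have "f ((1 - a / b) *\<^sub>R 0 + (a / b) *\<^sub>R b) \<le> (1 - a / b) * f 0 + (a / b) * f b"
    using assms by (intro convex_onD) auto
  then show ?thesis
    using assms by (simp add: field_simps)
qed

lemma convex_through_zero_mono:
  fixes f :: "real \<Rightarrow> real"
  assumes "convex_on {0..} f" "f 0 = 0" "\<And>v. 0 \<le> v \<Longrightarrow> 0 \<le> f v" "0 \<le> a" "a \<le> b"
  shows "f a \<le> f b"
proof (cases "a = 0")
  case False
  then have ab: "0 < a" "0 < b"
    using assms by auto
  have "f a = a * (f a / a)"
    using ab by simp
  also have "\<dots> \<le> b * (f b / b)"
    using ab assms by (intro mult_mono convex_through_zero_ratio_mono) auto
  finally show ?thesis
    using ab by simp
qed (use assms in auto)

lemma convex_supporting_line: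
  fixes f :: "real \<Rightarrow> real"
  assumes "convex_on {0..} f" "0 < a"
  obtains m where "\<And>v. 0 \<le> v \<Longrightarrow> f a + m * (v - a) \<le> f v"
  using convex_le_Inf_differential[OF assms(1), of a] assms(2) by auto

section \<open>The scalar differential inequality\<close>

text \<open>
  The bounded primitive of \<open>1 / f\<close> that Osgood's argument needs. The integrability hypothesis
  concerns \<open>{1..}\<close> only; below \<open>1\<close>, continuity and positivity of \<open>f\<close> on \<open>{b..1}\<close> suffice, so
  that \<open>b > 0\<close> can be taken as small as desired.
\<close>

lemma integral_inverse_reaction_bounded:
  fixes f :: "real \<Rightarrow> real"
  assumes f: "convex_on {0..} f" "\<And>v. 0 < v \<Longrightarrow> 0 < f v"
    and int: "(\<integral>\<^sup>+v\<in>{1..}. ennreal (1 / f v) \<partial>lborel) < \<infinity>"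
    and b: "0 < b" "b \<le> 1"
  obtains K where "\<And>v. b \<le> v \<Longrightarrow> integral {b..v} (\<lambda>y. 1 / f y) \<le> K"
proof -
  let ?I = "\<lambda>c d. integral {c..d} (\<lambda>y. 1 / f y)"
  have fcont: "continuous_on {0<..} f"
    by (intro convex_on_continuous convex_on_subset[OF f(1)]) auto
  have int_on: "(\<lambda>y. 1 / f y) integrable_on {c..d}" if "0 < c" for c d
  proof (intro integrable_continuous_real continuous_on_divide continuous_on_const)
    show "continuous_on {c..d} f"
      using fcont by (rule continuous_on_subset) (use that in auto)
    show "\<forall>y\<in>{c..d}. f y \<noteq> 0"
      using that f(2) by (metis atLeastAtMost_iff less_irrefl less_le_trans)
  qed
  have nonneg: "0 \<le> ?I c d" if "0 < c" for c d
    using that f(2) by (intro integral_nonneg int_on) (force intro: less_imp_le)+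
  obtain R where R: "0 \<le> R" "(\<integral>\<^sup>+v\<in>{1..}. ennreal (1 / f v) \<partial>lborel) = ennreal R"
    using int by (cases "\<integral>\<^sup>+v\<in>{1..}. ennreal (1 / f v) \<partial>lborel") auto
  have tail: "?I 1 V \<le> R" for V
  proof -
    have "ennreal (?I 1 V) = (\<integral>\<^sup>+v\<in>{1..V}. ennreal (1 / f v) \<partial>lborel)"
      using f(2) by (intro nn_integral_has_integral_lebesgue'[symmetric] integrable_integral int_on)
        (auto intro: less_imp_le)
    also have "\<dots> \<le> (\<integral>\<^sup>+v\<in>{1..}. ennreal (1 / f v) \<partial>lborel)"
      by (intro nn_integral_mono) (auto simp: indicator_def)
    finally show ?thesis
      using R by (simp add: ennreal_le_iff)
  qed
  have "?I b v \<le> ?I b 1 + R" if "b \<le> v" for v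
  proof -
    define V where "V = max v 1"
    have "?I b v + ?I v V = ?I b V" "?I b 1 + ?I 1 V = ?I b V"
      using b that int_on[OF b(1)]
      by (auto intro!: Henstock_Kurzweil_Integration.integral_combine simp: V_def)
    then show ?thesis
      using nonneg[of v V] tail[of V] b that by linarith
  qed
  then show thesis
    by (rule that)
qed

text \<open>
  The reaction beats the linear loss at \<open>\<Phi> 0\<close>, and this persists. For persistence, replace the
  convex function \<open>f v - L * v\<close> by its supporting line at \<open>\<Phi> 0\<close>: the resulting linear inequality
  for \<open>\<Phi>\<close> is solved with an integrating factor and yields \<open>\<Phi> t \<ge> \<Phi> 0\<close>, without any comparison
  principle. Since \<open>f v / v\<close> is nondecreasing, the loss then remains a fixed fraction of the
  reaction, so \<open>\<Phi>' \<ge> c * f \<Phi>\<close> with \<open>c > 0\<close>. A primitive of \<open>1 / f\<close> along \<open>\<Phi>\<close> therefore grows at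
  least linearly, but it is bounded.
\<close>

lemma no_global_supersolution_of_reaction_ode:
  fixes f \<Phi> \<Phi>' :: "real \<Rightarrow> real"
  assumes f: "convex_on {0..} f" "f 0 = 0" "\<And>v. 0 < v \<Longrightarrow> 0 < f v"
    and int: "(\<integral>\<^sup>+v\<in>{1..}. ennreal (1 / f v) \<partial>lborel) < \<infinity>"
    and cont: "\<And>t. 0 < t \<Longrightarrow> continuous_on {0..t} \<Phi>"
    and nonneg: "\<And>t. 0 \<le> t \<Longrightarrow> 0 \<le> \<Phi> t"
    and deriv: "\<And>t. 0 < t \<Longrightarrow> (\<Phi> has_real_derivative \<Phi>' t) (at t)"
    and ineq: "\<And>t. 0 < t \<Longrightarrow> f (\<Phi> t) - L * \<Phi> t \<le> \<Phi>' t"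
    and L: "0 \<le> L" and a: "0 < \<Phi> 0" "L * \<Phi> 0 < f (\<Phi> 0)"
  shows False
proof -
  define a where "a = \<Phi> 0"
  have a0: "0 < a" and La: "L * a < f a"
    using a by (auto simp: a_def)
  have cont_sub: "continuous_on {0..t} \<Phi>" for t
    using cont[of "max t 1"] by (rule continuous_on_subset) auto
  obtain m where m: "\<And>v. 0 \<le> v \<Longrightarrow> f a + m * (v - a) \<le> f v"
    using convex_supporting_line[OF f(1) a0] by blast
  have above: "a \<le> \<Phi> t" if "0 \<le> t" for t
  proof -
    \<comment> \<open>The inequality \<open>(\<Phi> - a)' \<ge> (m - L) * (\<Phi> - a)\<close> says that this function is nondecreasing.\<close>
    define \<psi> where "\<psi> = (\<lambda>s. exp (- (m - L) * s) * (\<Phi> s - a))"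
    have "\<psi> 0 \<le> \<psi> t"
    proof (rule DERIV_nonneg_imp_increasing_open[OF that])
      fix s assume s: "0 < s" "s < t"
      have "(\<psi> has_real_derivative exp (- (m - L) * s) * (\<Phi>' s - (m - L) * (\<Phi> s - a))) (at s)"
        unfolding \<psi>_def using deriv[OF s(1)]
        by (auto intro!: derivative_eq_intros simp: algebra_simps)
      moreover have "0 \<le> \<Phi>' s - (m - L) * (\<Phi> s - a)"
        using ineq[OF s(1)] m[OF nonneg, of s] s La by (simp add: algebra_simps)
      ultimately show "\<exists>y. (\<psi> has_real_derivative y) (at s) \<and> 0 \<le> y"
        by (intro exI conjI) auto
    qed (auto simp: \<psi>_def intro!: continuous_intros cont_sub)
    then show ?thesis
      by (simp add: \<psi>_def a_def[symmetric] zero_le_mult_iff)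
  qed
  define c where "c = 1 - L * a / f a"
  have fa: "0 < f a"
    using f(3) a0 .
  have c: "0 < c"
    using La fa by (simp add: c_def)
  have growth: "c * f (\<Phi> t) \<le> \<Phi>' t" if "0 < t" for t
  proof -
    have \<Phi>: "a \<le> \<Phi> t" "0 < \<Phi> t"
      using above[of t] that a0 by auto
    have "f a / a \<le> f (\<Phi> t) / \<Phi> t"
      by (rule convex_through_zero_ratio_mono[OF f(1,2) a0 \<Phi>(1)])
    then have "\<Phi> t \<le> a / f a * f (\<Phi> t)"
      using a0 fa \<Phi> by (simp add: field_simps)
    from mult_left_mono[OF this L] show ?thesis
      using ineq[OF that] by (simp add: c_def algebra_simps)
  qed
  \<comment> \<open>The base point of the primitive lies strictly below all values of \<open>\<Phi>\<close>, so the primitive is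
    differentiable at each of them.\<close>
  define b where "b = min a 1 / 2"
  have b: "0 < b" "b \<le> 1" "b < a"
    using a0 by (auto simp: b_def)
  define G where "G = (\<lambda>v. integral {b..v} (\<lambda>y. 1 / f y))"
  have fcont: "continuous_on {0<..} f"
    by (intro convex_on_continuous convex_on_subset[OF f(1)]) auto
  have dG: "(G has_real_derivative 1 / f v) (at v)" if "b < v" for v
  proof -
    have "(G has_real_derivative 1 / f v) (at v within {b..v + 1})"
      unfolding G_def
    proof (intro integral_has_real_derivative continuous_on_divide continuous_on_const)
      show "continuous_on {b..v + 1} f"
        using fcont by (rule continuous_on_subset) (use b in auto)
      show "\<forall>y\<in>{b..v + 1}. f y \<noteq> 0"
        using b(1) f(3) by (metis atLeastAtMost_iff less_irrefl less_le_trans)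
    qed (use that in auto)
    moreover have "at v within {b..v + 1} = at v"
      using that by (intro at_within_Icc_at) auto
    ultimately show ?thesis
      by simp
  qed
  have linear: "c * t \<le> G (\<Phi> t) - G a" if "0 \<le> t" for t
  proof -
    have "G (\<Phi> 0) - c * 0 \<le> G (\<Phi> t) - c * t"
    proof (rule DERIV_nonneg_imp_increasing_open[OF that])
      fix s assume s: "0 < s" "s < t"
      have \<Phi>: "b < \<Phi> s"
        using above[of s] s b by auto
      have "((\<lambda>s. G (\<Phi> s) - c * s) has_real_derivative 1 / f (\<Phi> s) * \<Phi>' s - c) (at s)"
        using DERIV_chain2[OF dG[OF \<Phi>] deriv[OF s(1)]]
        by (auto intro!: derivative_eq_intros)
      moreover have "0 \<le> 1 / f (\<Phi> s) * \<Phi>' s - c"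
        using growth[OF s(1)] f(3)[of "\<Phi> s"] \<Phi> b by (simp add: field_simps)
      ultimately show "\<exists>y. ((\<lambda>s. G (\<Phi> s) - c * s) has_real_derivative y) (at s) \<and> 0 \<le> y"
        by blast
    next
      have "continuous_on {b<..} G"
        using dG by (intro DERIV_continuous_on[where D="\<lambda>v. 1 / f v"])
          (auto intro: has_field_derivative_at_within)
      moreover have "\<Phi> ` {0..t} \<subseteq> {b<..}"
        using above b(3) by force
      ultimately show "continuous_on {0..t} (\<lambda>s. G (\<Phi> s) - c * s)"
        by (intro continuous_intros continuous_on_compose2[OF _ cont_sub])
    qed
    then show ?thesis
      by (simp add: a_def)
  qed
  obtain K where K: "\<And>v. b \<le> v \<Longrightarrow> G v \<le> K"
    unfolding G_def using integral_inverse_reaction_bounded[OF f(1,3) int b(1,2)] by blast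
  \<comment> \<open>At this time the linear lower bound exceeds the upper bound of the primitive.\<close>
  define t where "t = (\<bar>K - G a\<bar> + 1) / c"
  have "0 \<le> t"
    using c by (simp add: t_def)
  then have "c * t \<le> K - G a"
    using linear[of t] K[of "\<Phi> t"] above[of t] b(3) by linarith
  moreover have "c * t = \<bar>K - G a\<bar> + 1"
    using c by (simp add: t_def)
  ultimately show False
    by linarith
qed

section \<open>Weighted sums over a countable set\<close>

lemma summable_on_mult_bounded:
  fixes w g :: "'a \<Rightarrow> real"
  assumes "w summable_on A" "\<And>x. x \<in> A \<Longrightarrow> 0 \<le> w x" "\<And>x. x \<in> A \<Longrightarrow> \<bar>g x\<bar> \<le> B"
  shows "(\<lambda>x. w x * g x) summable_on A"
proof -
  have "(\<lambda>x. norm (w x * B)) summable_on A"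
    using summable_on_cmult_left[OF assms(1)] by (rule summable_on_iff_abs_summable_on_real[THEN iffD1])
  then have "(\<lambda>x. norm (w x * g x)) summable_on A"
  proof (rule Infinite_Sum.abs_summable_on_comparison_test)
    fix x assume x: "x \<in> A"
    have "\<bar>g x\<bar> \<le> \<bar>B\<bar>" using assms(3)[OF x] by linarith
    then show "norm (w x * g x) \<le> norm (w x * B)"
      unfolding real_norm_def abs_mult by (rule mult_left_mono) simp
  qed
  then show ?thesis
    by (rule summable_on_iff_abs_summable_on_real[THEN iffD2])
qed

lemma infsum_sum_swap:
  fixes h :: "'i \<Rightarrow> 'a \<Rightarrow> real"
  assumes "finite I" "\<And>i. i \<in> I \<Longrightarrow> h i summable_on A"
  shows "(\<Sum>\<^sub>\<infinity>x\<in>A. \<Sum>i\<in>I. h i x) = (\<Sum>i\<in>I. infsum (h i) A)"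
proof -
  have "((\<lambda>x. \<Sum>i\<in>I. h i x) has_sum (\<Sum>i\<in>I. infsum (h i) A)) A"
    using assms by (induction I rule: finite_induct) (auto intro!: has_sum_add has_sum_infsum)
  then show ?thesis
    by (rule infsumI)
qed

text \<open>
  Sum the supporting line of \<open>f\<close> at the mean \<open>a\<close> against \<open>w\<close>. The boundary point \<open>a = 0\<close> is treated
  directly: there the left-hand side vanishes, and the right-hand side is nonnegative.
\<close>

lemma Jensen_weighted_infsum:
  fixes w v :: "'a \<Rightarrow> real"
  assumes f: "convex_on {0..} f" "f 0 = 0" "\<And>y. 0 \<le> y \<Longrightarrow> 0 \<le> f y"
    and w: "w summable_on UNIV" "\<And>x. 0 \<le> w x" "0 < infsum w UNIV"
    and v: "\<And>x. 0 \<le> v x" "\<And>x. v x \<le> B"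
  shows "infsum w UNIV * f ((\<Sum>\<^sub>\<infinity>x. w x * v x) / infsum w UNIV) \<le> (\<Sum>\<^sub>\<infinity>x. w x * f (v x))"
proof -
  define S where "S = infsum w UNIV"
  define a where "a = (\<Sum>\<^sub>\<infinity>x. w x * v x) / S"
  have S: "0 < S" and aS: "(\<Sum>\<^sub>\<infinity>x. w x * v x) = S * a"
    using w by (auto simp: S_def a_def)
  have a0: "0 \<le> a"
    unfolding a_def using S v w by (intro divide_nonneg_pos infsum_nonneg) auto
  have sv: "(\<lambda>x. w x * v x) summable_on UNIV"
    using w v by (intro summable_on_mult_bounded[where B=B]) auto
  have sf: "(\<lambda>x. w x * f (v x)) summable_on UNIV"
    using w v f convex_through_zero_mono[OF f]
    by (intro summable_on_mult_bounded[where B="f B"]) (auto simp: abs_of_nonneg)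
  show ?thesis
  proof (cases "a = 0")
    case True
    then show ?thesis
      using w v f by (auto intro!: infsum_nonneg simp: a_def S_def)
  next
    case False
    then obtain m where m: "\<And>y. 0 \<le> y \<Longrightarrow> f a + m * (y - a) \<le> f y"
      using a0 convex_supporting_line[OF f(1), of a] by auto
    have "S * f a = (\<Sum>\<^sub>\<infinity>x. w x * (f a - m * a) + m * (w x * v x))"
    proof -
      have "(\<Sum>\<^sub>\<infinity>x. w x * (f a - m * a) + m * (w x * v x))
          = (\<Sum>\<^sub>\<infinity>x. w x * (f a - m * a)) + (\<Sum>\<^sub>\<infinity>x. m * (w x * v x))"
        by (intro infsum_add summable_on_cmult_left summable_on_cmult_right sv w)
      also have "\<dots> = S * (f a - m * a) + m * (S * a)"
        by (simp only: infsum_cmult_left' infsum_cmult_right' aS S_def)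
      also have "\<dots> = S * f a"
        by (simp add: algebra_simps)
      finally show ?thesis
        by (rule sym)
    qed
    also have "\<dots> \<le> (\<Sum>\<^sub>\<infinity>x. w x * f (v x))"
    proof (rule infsum_mono)
      show "(\<lambda>x. w x * (f a - m * a) + m * (w x * v x)) summable_on UNIV"
        using sv w by (intro summable_on_add summable_on_cmult_left summable_on_cmult_right)
      show "w x * (f a - m * a) + m * (w x * v x) \<le> w x * f (v x)" for x
        using mult_left_mono[OF m[OF v(1)[of x]] w(2)[of x]] by (simp add: algebra_simps)
    qed (rule sf)
    finally show ?thesis
      by (simp add: a_def S_def)
  qed
qed

text \<open>
  This turns a sum over a countable type into an ordinary series, so that the theorem on termwise
  differentiation of series becomes applicable. Padding with zeros outside the range of \<^const>\<open>to_nat\<close>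
  avoids a case distinction between finite and infinite types.
\<close>

lemma sums_infsum_to_nat:
  fixes f :: "'a::countable \<Rightarrow> real"
  assumes "f summable_on UNIV"
  shows "(\<lambda>n. if n \<in> range (to_nat :: 'a \<Rightarrow> nat) then f (from_nat n) else 0) sums infsum f UNIV"
proof -
  have "(f has_sum infsum f UNIV) UNIV"
    using assms by simp
  then have "((\<lambda>n. f (from_nat n)) has_sum infsum f UNIV) (range (to_nat :: 'a \<Rightarrow> nat))"
    by (subst has_sum_reindex) (auto simp: o_def)
  then have "((\<lambda>n. if n \<in> range (to_nat :: 'a \<Rightarrow> nat) then f (from_nat n) else 0)
      has_sum infsum f UNIV) UNIV"
    by (subst has_sum_cong_neutral[where T = "range (to_nat :: 'a \<Rightarrow> nat)"
          and g = "\<lambda>n. f (from_nat n)"]) auto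
  then show ?thesis
    by (rule has_sum_imp_sums)
qed

lemma has_real_derivative_weighted_infsum:
  fixes w :: "'a::countable \<Rightarrow> real" and v v' :: "'a \<Rightarrow> real \<Rightarrow> real"
  assumes w: "w summable_on UNIV" "\<And>x. 0 \<le> w x"
    and v: "\<And>x s. a < s \<Longrightarrow> s < b \<Longrightarrow> (v x has_real_derivative v' x s) (at s)"
    and B: "\<And>x s. a < s \<Longrightarrow> s < b \<Longrightarrow> \<bar>v x s\<bar> \<le> B"
    and B': "\<And>x s. a < s \<Longrightarrow> s < b \<Longrightarrow> \<bar>v' x s\<bar> \<le> B'"
    and t: "a < t" "t < b"
  shows "((\<lambda>s. \<Sum>\<^sub>\<infinity>x. w x * v x s) has_real_derivative (\<Sum>\<^sub>\<infinity>x. w x * v' x t)) (at t)"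
proof -
  define R where "R = range (to_nat :: 'a \<Rightarrow> nat)"
  define F where "F = (\<lambda>n s. if n \<in> R then w (from_nat n) * v (from_nat n) s else 0)"
  define F' where "F' = (\<lambda>n s. if n \<in> R then w (from_nat n) * v' (from_nat n) s else 0)"
  define M where "M = (\<lambda>n. if n \<in> R then w (from_nat n) * B' else 0)"
  have F: "(\<lambda>n. F n s) sums (\<Sum>\<^sub>\<infinity>x. w x * v x s)" if "a < s" "s < b" for s
    unfolding F_def R_def
    using sums_infsum_to_nat[OF summable_on_mult_bounded[OF w, of "\<lambda>x. v x s" B]] B that by auto
  have F': "(\<lambda>n. F' n s) sums (\<Sum>\<^sub>\<infinity>x. w x * v' x s)" if "a < s" "s < b" for s
    unfolding F'_def R_def
    using sums_infsum_to_nat[OF summable_on_mult_bounded[OF w, of "\<lambda>x. v' x s" B']] B' that by auto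
  have M: "summable M"
    unfolding M_def R_def
    using sums_summable[OF sums_infsum_to_nat[OF summable_on_cmult_left[OF w(1), of B']]] by simp
  have "((\<lambda>s. \<Sum>n. F n s) has_real_derivative (\<Sum>n. F' n t)) (at t)"
  proof (rule has_field_derivative_series'(2)[where S="{a<..<b}" and x0=t])
    show "(F n has_real_derivative F' n s) (at s within {a<..<b})" if "s \<in> {a<..<b}" for n s
      using that unfolding F_def F'_def
      by (auto intro!: DERIV_cmult intro: has_field_derivative_at_within[OF v])
    show "uniformly_convergent_on {a<..<b} (\<lambda>n s. \<Sum>i<n. F' i s)"
    proof (rule Weierstrass_m_test'[OF _ M])
      show "norm (F' n s) \<le> M n" if "s \<in> {a<..<b}" for n s
        using that w B' by (auto simp: F'_def M_def abs_mult intro!: mult_left_mono)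
    qed
    show "summable (\<lambda>n. F n t)"
      using F t sums_summable by blast
  qed (use t in \<open>auto simp: interior_open\<close>)
  then have "((\<lambda>s. \<Sum>n. F n s) has_real_derivative (\<Sum>\<^sub>\<infinity>x. w x * v' x t)) (at t)"
    using F' t sums_unique by metis
  then show ?thesis
  proof (rule DERIV_cong_ev[OF refl _ refl, THEN iffD1, rotated])
    have "eventually (\<lambda>s. s \<in> {a<..<b}) (nhds t)"
      using t by (intro eventually_nhds_in_open) auto
    then show "\<forall>\<^sub>F s in nhds t. (\<Sum>n. F n s) = (\<Sum>\<^sub>\<infinity>x. w x * v x s)"
      by eventually_elim (simp add: sums_unique[OF F, symmetric])
  qed
qed

lemma continuous_on_weighted_infsum:
  fixes w :: "'a \<Rightarrow> real" and v :: "'a \<Rightarrow> real \<Rightarrow> real"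
  assumes w: "w summable_on UNIV" "\<And>x. 0 \<le> w x"
    and v: "\<And>x. continuous_on A (v x)" "\<And>x s. s \<in> A \<Longrightarrow> \<bar>v x s\<bar> \<le> B"
  shows "continuous_on A (\<lambda>s. \<Sum>\<^sub>\<infinity>x. w x * v x s)"
proof (rule uniform_limit_theorem)
  show "uniform_limit A (\<lambda>X s. \<Sum>x\<in>X. w x * v x s) (\<lambda>s. \<Sum>\<^sub>\<infinity>x. w x * v x s)
      (finite_subsets_at_top UNIV)"
    using w v by (intro Weierstrass_m_test_general[where M="\<lambda>x. w x * B"])
      (auto simp: abs_mult intro!: mult_left_mono summable_on_cmult_left)
qed (use v in \<open>auto intro!: continuous_intros always_eventually\<close>)

section \<open>The lattice Laplacian and the Gaussian weight\<close>

lemma lattice_laplacian_stencil: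
  fixes g :: "int ^ 'n \<Rightarrow> real"
  shows "lattice_laplacian g x =
    1 / (2 * real CARD('n)) * (\<Sum>i\<in>UNIV. g (x + axis i 1) + g (x - axis i 1) - 2 * g x)"
proof -
  let ?h = "\<lambda>(i, d). x + axis i d"
  have inj: "inj_on ?h (UNIV \<times> {1, - 1})"
    by (auto simp: inj_on_def axis_eq_axis)
  have "{y. lattice_adj x y} = ?h ` (UNIV \<times> {1, - 1})"
  proof (intro equalityI subsetI)
    fix y assume "y \<in> {y. lattice_adj x y}"
    then obtain i where i: "\<bar>x $ i - y $ i\<bar> = 1" "\<forall>j. j \<noteq> i \<longrightarrow> x $ j = y $ j"
      by (auto simp: lattice_adj_def)
    have "y = ?h (i, y $ i - x $ i)"
      using i(2) by (auto simp: vec_eq_iff axis_def)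
    moreover have "(i, y $ i - x $ i) \<in> UNIV \<times> {1, - 1}"
      using i(1) by auto
    ultimately show "y \<in> ?h ` (UNIV \<times> {1, - 1})"
      by (rule image_eqI)
  next
    fix y assume "y \<in> ?h ` (UNIV \<times> {1, - 1})"
    then obtain i d where "y = x + axis i d" "d = 1 \<or> d = - 1"
      by auto
    then show "y \<in> {y. lattice_adj x y}"
      unfolding lattice_adj_def by (intro CollectI exI[of _ i]) (auto simp: axis_def)
  qed
  then have "(\<Sum>y | lattice_adj x y. g y - g x) = (\<Sum>p\<in>UNIV \<times> {1, - 1}. g (?h p) - g x)"
    by (simp add: sum.reindex[OF inj] o_def)
  also have "\<dots> = (\<Sum>i\<in>UNIV. \<Sum>d\<in>{1, - 1}. g (x + axis i d) - g x)"
    by (subst sum.cartesian_product) (simp only: case_prod_unfold)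
  also have "\<dots> = (\<Sum>i\<in>UNIV. g (x + axis i 1) + g (x - axis i 1) - 2 * g x)"
  proof (rule sum.cong)
    fix i :: 'n
    have "axis i (- 1 :: int) = - axis i 1"
      by (auto simp: vec_eq_iff axis_def)
    then show "(\<Sum>d\<in>{1, - 1}. g (x + axis i d) - g x) =
        g (x + axis i 1) + g (x - axis i 1) - 2 * g x"
      by simp
  qed simp
  finally show ?thesis
    by (simp add: lattice_laplacian_eq)
qed

lemma abs_lattice_laplacian_le:
  fixes g :: "int ^ 'n \<Rightarrow> real"
  assumes "\<And>x. \<bar>g x\<bar> \<le> B"
  shows "\<bar>lattice_laplacian g x\<bar> \<le> 2 * B"
proof -
  have "\<bar>\<Sum>i\<in>UNIV. g (x + axis i 1) + g (x - axis i 1) - 2 * g x\<bar> \<le> (\<Sum>i\<in>(UNIV::'n set). 4 * B)"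
  proof (rule order_trans[OF sum_abs sum_mono])
    show "\<bar>g (x + axis i 1) + g (x - axis i 1) - 2 * g x\<bar> \<le> 4 * B" for i
      using assms[of "x + axis i 1"] assms[of "x - axis i 1"] assms[of x] by linarith
  qed
  then show ?thesis
    by (simp add: lattice_laplacian_stencil abs_mult field_simps)
qed

definition gaussian :: "real \<Rightarrow> int ^ 'n \<Rightarrow> real" where
  "gaussian k x = exp (- k * (euclid_norm x)\<^sup>2)"

lemma gaussian_pos [simp]: "0 < gaussian k x" and gaussian_nonneg [simp]: "0 \<le> gaussian k x"
  by (simp_all add: gaussian_def)

lemma euclid_norm_squared: "(euclid_norm x)\<^sup>2 = (\<Sum>i\<in>UNIV. (real_of_int (x $ i))\<^sup>2)"
  by (simp add: euclid_norm_def sum_nonneg)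

lemma gaussian_prod: "gaussian k x = (\<Prod>i\<in>UNIV. exp (- k * (real_of_int (x $ i))\<^sup>2))"
  by (simp add: gaussian_def euclid_norm_squared sum_distrib_left flip: exp_sum)

text \<open>
  The identity \<open>|x + d e\<^sub>i|\<^sup>2 = |x|\<^sup>2 + 2 d x\<^sub>i + d\<^sup>2\<close>, where \<open>e\<^sub>i\<close> is the \<open>i\<close>-th unit vector.
\<close>

lemma gaussian_shift:
  "gaussian k (x + axis i d) = gaussian k x * exp (- k * (2 * d * x $ i + d\<^sup>2))"
proof -
  have "(euclid_norm (x + axis i d))\<^sup>2
      = (\<Sum>j\<in>UNIV. (real_of_int (x $ j))\<^sup>2 + (if j = i then real_of_int (2 * d * x $ j + d\<^sup>2) else 0))"
    unfolding euclid_norm_squared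
    by (intro sum.cong) (auto simp: axis_def power2_sum algebra_simps)
  also have "\<dots> = (euclid_norm x)\<^sup>2 + (2 * d * x $ i + d\<^sup>2)"
    by (simp add: sum.distrib euclid_norm_squared)
  finally show ?thesis
    by (simp add: gaussian_def flip: exp_add) (simp add: algebra_simps)
qed

text \<open>
  By the shift formula the two neighbours in direction \<open>i\<close> contribute
  \<open>gaussian k x * exp (- k) * (s + 1 / s)\<close> with \<open>s = exp (- 2 * k * x\<^sub>i)\<close>, and \<open>s + 1 / s \<ge> 2\<close>.
\<close>

lemma gaussian_neighbours_ge:
  "2 * exp (- k) * gaussian k x \<le> gaussian k (x + axis i 1) + gaussian k (x - axis i 1)"
proof -
  define s where "s = exp (- 2 * k * x $ i)"
  have s: "0 < s" by (simp add: s_def)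
  have neg: "x - axis i 1 = x + axis i (- 1)"
    by (auto simp: vec_eq_iff axis_def)
  have "gaussian k (x + axis i 1) + gaussian k (x - axis i 1) = gaussian k x * exp (- k) * (s + 1 / s)"
    unfolding neg gaussian_shift s_def
    by (simp add: exp_diff exp_add exp_minus field_simps)
  moreover have "2 \<le> s + 1 / s"
    using s zero_le_power2[of "s - 1"] by (simp add: field_simps power2_eq_square)
  then have "gaussian k x * exp (- k) * 2 \<le> gaussian k x * exp (- k) * (s + 1 / s)"
    by (intro mult_left_mono) auto
  ultimately show ?thesis
    by (simp add: algebra_simps)
qed

lemma summable_on_exp_minus_square:
  assumes "0 < k"
  shows "(\<lambda>m::int. exp (- k * (real_of_int m)\<^sup>2)) summable_on UNIV"
proof -
  let ?e = "\<lambda>m::int. exp (- k * (real_of_int m)\<^sup>2)"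
  have "summable (\<lambda>n. exp (- k) ^ n)"
    using assms by (intro summable_geometric) auto
  then have "summable (\<lambda>n. exp (- k * (real n)\<^sup>2))"
  proof (rule summable_comparison_test')
    show "norm (exp (- k * (real n)\<^sup>2)) \<le> exp (- k) ^ n" if "0 \<le> n" for n
    proof -
      have "real n \<le> (real n)\<^sup>2"
        by (cases n) (auto simp: power2_eq_square)
      then show ?thesis
        using assms by (simp flip: exp_of_nat_mult)
    qed
  qed
  then have s: "(\<lambda>n. exp (- k * (real n)\<^sup>2)) summable_on A" for A
    by (intro summable_on_subset_banach[OF summable_nonneg_imp_summable_on]) auto
  have "?e summable_on range int"
    using s[of UNIV] by (subst summable_on_reindex) (auto simp: o_def)
  moreover have "?e summable_on ((\<lambda>n. - int n) ` {1..})"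
    using s[of "{1..}"] by (subst summable_on_reindex) (auto simp: o_def inj_on_def)
  ultimately have "?e summable_on (range int \<union> (\<lambda>n. - int n) ` {1..})"
    by (rule summable_on_Un_disjoint) auto
  moreover have "m \<in> range int \<union> (\<lambda>n. - int n) ` {1..}" for m
    by (cases m rule: int_cases3) auto
  then have "range int \<union> (\<lambda>n. - int n) ` {1..} = UNIV"
    by auto
  ultimately show ?thesis
    by simp
qed

lemma theta_pos:
  assumes "0 < k"
  shows "0 < theta (k / pi)"
proof -
  have "theta (k / pi) = (\<Sum>\<^sub>\<infinity>m::int. exp (- k * (real_of_int m)\<^sup>2))"
    by (simp add: theta_def mult.commute)
  moreover have "(\<Sum>\<^sub>\<infinity>m\<in>{0}. exp (- k * (real_of_int m)\<^sup>2))
      \<le> (\<Sum>\<^sub>\<infinity>m::int. exp (- k * (real_of_int m)\<^sup>2))"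
    using summable_on_exp_minus_square[OF assms] by (intro infsum_mono2) auto
  ultimately show ?thesis
    by simp
qed

text \<open>
  The Gaussian is a product over the coordinates, so its sum over the lattice is a product of
  one-dimensional sums, each of which is the theta series.
\<close>

lemma infsum_gaussian:
  assumes "0 < k"
  shows "(\<Sum>\<^sub>\<infinity>x. gaussian k (x :: int ^ 'n)) = theta (k / pi) ^ CARD('n)"
proof -
  have bij: "bij_betw vec_nth (UNIV :: (int ^ 'n) set) (PiE UNIV (\<lambda>_. UNIV))"
    by (intro bij_betwI[where g=vec_lambda]) auto
  have "(\<Sum>\<^sub>\<infinity>x. gaussian k (x :: int ^ 'n)) =
      (\<Sum>\<^sub>\<infinity>h\<in>PiE (UNIV :: 'n set) (\<lambda>_. UNIV). \<Prod>i\<in>UNIV. exp (- k * (real_of_int (h i))\<^sup>2))"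
    unfolding gaussian_prod by (rule infsum_reindex_bij_betw[OF bij])
  also have "\<dots> = (\<Prod>i\<in>(UNIV :: 'n set). \<Sum>\<^sub>\<infinity>m::int. exp (- k * (real_of_int m)\<^sup>2))"
    using summable_on_exp_minus_square[OF assms] by (intro infsum_prod_PiE_abs) auto
  finally show ?thesis
    by (simp add: theta_def mult.commute)
qed

text \<open>
  A sum that does not converge is \<open>0\<close> by convention, whereas the value computed above is positive.
\<close>

lemma summable_gaussian:
  assumes "0 < k"
  shows "gaussian k summable_on (UNIV :: (int ^ 'n) set)"
proof (rule ccontr)
  assume "\<not> gaussian k summable_on (UNIV :: (int ^ 'n) set)"
  then have "(\<Sum>\<^sub>\<infinity>x. gaussian k (x :: int ^ 'n)) = 0"
    by (rule infsum_not_exists)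
  then show False
    using infsum_gaussian[OF assms, where 'n='n] theta_pos[OF assms] by simp
qed

text \<open>
  Summation by parts moves the Laplacian onto the Gaussian, for which
  \<open>\<Delta> w \<ge> - (1 - exp (- k)) * w\<close> by \<open>gaussian_neighbours_ge\<close>. Summation by parts is here only the
  translation invariance of the sum over the lattice, applied in each coordinate direction.
\<close>

lemma gaussian_laplacian_ge:
  fixes g :: "int ^ 'n \<Rightarrow> real"
  assumes k: "0 < k" and g: "\<And>x. 0 \<le> g x" "\<And>x. g x \<le> B"
  shows "- (1 - exp (- k)) * (\<Sum>\<^sub>\<infinity>x. gaussian k x * g x)
    \<le> (\<Sum>\<^sub>\<infinity>x. gaussian k x * lattice_laplacian g x)"
proof -
  let ?w = "gaussian k :: int ^ 'n \<Rightarrow> real"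
  define J where "J = (\<Sum>\<^sub>\<infinity>x. ?w x * g x)"
  note w = summable_gaussian[OF k, where 'n='n]
  have shift: "?w (x + c) * g x = (\<lambda>x. ?w x * g (x - c)) (x + c)" for x c
    by simp
  have bij: "bij (\<lambda>x. x + c)" for c :: "int ^ 'n"
    by (intro bij_betwI[where g="\<lambda>x. x - c"]) auto
  have summable_minus: "(\<lambda>x. ?w x * g (x - c)) summable_on UNIV" for c
    using g by (intro summable_on_mult_bounded[OF w, where B=B]) auto
  have summable_weight_plus: "(\<lambda>x. ?w (x + c) * g x) summable_on UNIV" for c
    unfolding shift using summable_minus by (subst summable_on_reindex_bij_betw[OF bij])
  have move_plus: "(\<Sum>\<^sub>\<infinity>x. ?w x * g (x - c)) = (\<Sum>\<^sub>\<infinity>x. ?w (x + c) * g x)" for c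
    unfolding shift by (subst infsum_reindex_bij_betw[OF bij]) simp
  have summable_here: "(\<lambda>x. ?w x * g x) summable_on UNIV"
    using summable_minus[of 0] by simp
  have summable_plus: "(\<lambda>x. ?w x * g (x + c)) summable_on UNIV" for c
    using summable_minus[of "- c"] by simp
  have move_minus: "(\<Sum>\<^sub>\<infinity>x. ?w x * g (x + c)) = (\<Sum>\<^sub>\<infinity>x. ?w (x - c) * g x)" for c
    using move_plus[of "- c"] by simp
  have summable_weight_minus: "(\<lambda>x. ?w (x - c) * g x) summable_on UNIV" for c
    using summable_weight_plus[of "- c"] by simp
  \<comment> \<open>The contribution of the \<open>i\<close>-th direction to the Laplacian, up to the factor \<open>1 / (2 N)\<close>.\<close>
  define D where "D = (\<lambda>i x. ?w x * (g (x + axis i 1) + g (x - axis i 1) - 2 * g x))"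
  have D: "D i = (\<lambda>x. ?w x * g (x + axis i 1) + ?w x * g (x - axis i 1)
      + (- 2) * (?w x * g x))" for i
    by (auto simp: D_def algebra_simps)
  have summable_D: "D i summable_on UNIV" for i
    unfolding D by (intro summable_on_add summable_minus summable_plus summable_on_cmult_right summable_here)
  have "2 * exp (- k) * J - 2 * J \<le> infsum (D i) UNIV" for i
  proof -
    have "2 * exp (- k) * J = (\<Sum>\<^sub>\<infinity>x. 2 * exp (- k) * (?w x * g x))"
      by (simp add: J_def infsum_cmult_right')
    also have "\<dots> \<le> (\<Sum>\<^sub>\<infinity>x. ?w (x - axis i 1) * g x + ?w (x + axis i 1) * g x)"
    proof (rule infsum_mono)
      show "2 * exp (- k) * (?w x * g x) \<le> ?w (x - axis i 1) * g x + ?w (x + axis i 1) * g x" for x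
        using mult_right_mono[OF gaussian_neighbours_ge[of k x i] g(1)[of x]]
        by (simp add: algebra_simps)
    qed (intro summable_on_add summable_on_cmult_right summable_here summable_weight_plus summable_weight_minus)+
    also have "\<dots> = (\<Sum>\<^sub>\<infinity>x. ?w x * g (x + axis i 1)) + (\<Sum>\<^sub>\<infinity>x. ?w x * g (x - axis i 1))"
      by (subst infsum_add[OF summable_weight_minus summable_weight_plus]) (simp add: move_plus move_minus)
    also have "\<dots> = infsum (D i) UNIV + 2 * J"
    proof -
      have "infsum (D i) UNIV = (\<Sum>\<^sub>\<infinity>x. ?w x * g (x + axis i 1))
          + (\<Sum>\<^sub>\<infinity>x. ?w x * g (x - axis i 1)) + (\<Sum>\<^sub>\<infinity>x. (- 2) * (?w x * g x))"
        unfolding D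
        by (simp only: infsum_add summable_on_add summable_minus summable_plus
            summable_on_cmult_right summable_here)
      then show ?thesis
        by (simp only: infsum_cmult_right' J_def)
    qed
    finally show ?thesis by simp
  qed
  then have "(\<Sum>i\<in>(UNIV::'n set). 2 * exp (- k) * J - 2 * J) \<le> (\<Sum>i\<in>UNIV. infsum (D i) UNIV)"
    by (intro sum_mono)
  also have "\<dots> = (\<Sum>\<^sub>\<infinity>x. \<Sum>i\<in>UNIV. D i x)"
    using summable_D by (simp add: infsum_sum_swap)
  also have "\<dots> = (\<Sum>\<^sub>\<infinity>x. (2 * real CARD('n)) * (?w x * lattice_laplacian g x))"
    by (intro infsum_cong) (simp add: D_def lattice_laplacian_stencil flip: sum_distrib_left)
  also have "\<dots> = (2 * real CARD('n)) * (\<Sum>\<^sub>\<infinity>x. ?w x * lattice_laplacian g x)"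
    by (simp only: infsum_cmult_right')
  finally have "(2 * real CARD('n)) * (- (1 - exp (- k)) * J)
      \<le> (2 * real CARD('n)) * (\<Sum>\<^sub>\<infinity>x. ?w x * lattice_laplacian g x)"
    by (simp add: algebra_simps)
  then show ?thesis
    unfolding J_def by (rule mult_left_le_imp_le) simp
qed

section \<open>Blow-up for a large Gaussian mean\<close>

text \<open>
  The Gaussian mean \<open>\<Phi>\<close> of a global solution would satisfy \<open>\<Phi>' \<ge> f \<Phi> - (1 - exp (- k)) * \<Phi>\<close> for all
  times: \<open>gaussian_laplacian_ge\<close> bounds the diffusion term and Jensen's inequality the reaction term.
  The mean may be differentiated under the sum because \<open>u\<close> is bounded on bounded time intervals, and
  hence so is its time derivative, by the equation.
\<close>

lemma no_global_solution:
  fixes u0 :: "int ^ 'n \<Rightarrow> real" and u :: "int ^ 'n \<Rightarrow> real \<Rightarrow> real"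
  assumes f: "convex_on {0..} f" "f 0 = 0" "\<And>v. 0 < v \<Longrightarrow> 0 < f v"
    and int: "(\<integral>\<^sup>+v\<in>{1..}. ennreal (1 / f v) \<partial>lborel) < \<infinity>"
    and k: "0 < k" and u0: "\<And>x. 0 \<le> u0 x"
    and sol: "is_solution f u0 \<infinity> u"
    and a_def: "a = (\<Sum>\<^sub>\<infinity>x. gaussian k x * u0 x) / theta (k / pi) ^ CARD('n)"
    and a: "0 < a" "(1 - exp (- k)) * a < f a"
  shows False
proof -
  let ?w = "gaussian k :: int ^ 'n \<Rightarrow> real"
  define S where "S = theta (k / pi) ^ CARD('n)"
  have S: "0 < S" "infsum ?w UNIV = S"
    using theta_pos[OF k] infsum_gaussian[OF k, where 'n='n] by (simp_all add: S_def)
  note w = summable_gaussian[OF k, where 'n='n]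
  have f_nonneg: "0 \<le> f v" if "0 \<le> v" for v
    using that f(2) f(3)[of v] by (cases "v = 0") auto
  have u_nonneg: "0 \<le> u x t" if "0 \<le> t" for x t
    using that sol u0 by (cases "t = 0") (auto simp: is_solution_def)
  have u_bounded: "\<exists>B. \<forall>x t. 0 \<le> t \<longrightarrow> t \<le> T' \<longrightarrow> \<bar>u x t\<bar> \<le> B" if "0 < T'" for T'
  proof -
    have "bounded {u x t | x t. 0 \<le> t \<and> t \<le> T'}"
      using sol that by (simp add: is_solution_def)
    then obtain B where "\<forall>y\<in>{u x t | x t. 0 \<le> t \<and> t \<le> T'}. norm y \<le> B"
      unfolding bounded_iff by blast
    then have "\<bar>u x t\<bar> \<le> B" if "0 \<le> t" "t \<le> T'" for x t
      using that by (metis (mono_tags, lifting) mem_Collect_eq real_norm_def)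
    then show ?thesis
      by blast
  qed
  \<comment> \<open>The time derivative of \<open>u x\<close>, as given by the equation.\<close>
  define u' where "u' = (\<lambda>x t. lattice_laplacian (\<lambda>y. u y t) x + f (u x t))"
  have du: "(u x has_real_derivative u' x t) (at t)" if "0 < t" for x t
  proof -
    have "u x C1_differentiable_on {t. 0 < t \<and> ereal t < \<infinity>}"
      using sol by (auto simp: is_solution_def)
    then obtain D where "\<forall>s\<in>{t. 0 < t \<and> ereal t < \<infinity>}. (u x has_vector_derivative D s) (at s)"
      unfolding C1_differentiable_on_def by blast
    then have D: "(u x has_real_derivative D t) (at t)"
      using that by (simp add: has_real_derivative_iff_has_vector_derivative)
    have "deriv (u x) t - lattice_laplacian (\<lambda>y. u y t) x = f (u x t)"
      using sol that by (auto simp: is_solution_def)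
    then show ?thesis
      using D DERIV_imp_deriv[OF D] by (simp add: u'_def algebra_simps)
  qed
  define \<Phi> where "\<Phi> = (\<lambda>t. (\<Sum>\<^sub>\<infinity>x. ?w x * u x t) / S)"
  define \<Phi>' where "\<Phi>' = (\<lambda>t. (\<Sum>\<^sub>\<infinity>x. ?w x * u' x t) / S)"
  show False
  proof (rule no_global_supersolution_of_reaction_ode[OF f int, where \<Phi>=\<Phi> and \<Phi>'=\<Phi>'])
    show "continuous_on {0..T'} \<Phi>" if T': "0 < T'" for T'
    proof -
      obtain B where B: "\<And>x t. 0 \<le> t \<Longrightarrow> t \<le> T' \<Longrightarrow> \<bar>u x t\<bar> \<le> B"
        using u_bounded[OF T'] by blast
      have "continuous_on {0..T'} (u x)" for x
        using sol by (auto simp: is_solution_def intro: continuous_on_subset)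
      then show ?thesis
        unfolding \<Phi>_def using B S(1)
        by (intro continuous_on_divide continuous_on_const continuous_on_weighted_infsum[OF w]) auto
    qed
    show "0 \<le> \<Phi> t" if "0 \<le> t" for t
      using S(1) u_nonneg[OF that] by (auto simp: \<Phi>_def intro!: divide_nonneg_pos infsum_nonneg)
    fix t :: real assume t: "0 < t"
    obtain B where B: "\<And>x s. 0 \<le> s \<Longrightarrow> s \<le> t + 1 \<Longrightarrow> \<bar>u x s\<bar> \<le> B"
      using u_bounded[of "t + 1"] t by auto
    have fB: "\<bar>f (u x s)\<bar> \<le> f B" if "0 \<le> s" "s \<le> t + 1" for x s
      using convex_through_zero_mono[OF f(1,2) f_nonneg] u_nonneg f_nonneg B[OF that, of x] that
      by (auto simp: abs_of_nonneg)
    have u'B: "\<bar>u' x s\<bar> \<le> 2 * B + f B" if "0 \<le> s" "s \<le> t + 1" for x s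
      using abs_lattice_laplacian_le[of "\<lambda>y. u y s" B x, OF B[OF that]] fB[OF that, of x]
      unfolding u'_def by linarith
    have "((\<lambda>s. \<Sum>\<^sub>\<infinity>x. ?w x * u x s) has_real_derivative (\<Sum>\<^sub>\<infinity>x. ?w x * u' x t)) (at t)"
      by (rule has_real_derivative_weighted_infsum[OF w, where a=0 and b="t + 1" and B=B
            and B'="2 * B + f B"])
        (use t B u'B du in auto)
    then show "(\<Phi> has_real_derivative \<Phi>' t) (at t)"
      unfolding \<Phi>_def \<Phi>'_def by (rule DERIV_cdivide)
    have Bt: "0 \<le> u x t" "u x t \<le> B" for x
      using u_nonneg[of t x] B[of t x] t by auto
    have "S * (f (\<Phi> t) - (1 - exp (- k)) * \<Phi> t)
        = S * f (\<Phi> t) + - (1 - exp (- k)) * (\<Sum>\<^sub>\<infinity>x. ?w x * u x t)"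
    proof -
      have mass: "S * \<Phi> t = (\<Sum>\<^sub>\<infinity>x. ?w x * u x t)"
        using S(1) by (simp add: \<Phi>_def)
      show ?thesis
        by (simp only: mass[symmetric]) (simp add: algebra_simps)
    qed
    also have "\<dots> \<le> (\<Sum>\<^sub>\<infinity>x. ?w x * f (u x t)) + (\<Sum>\<^sub>\<infinity>x. ?w x * lattice_laplacian (\<lambda>y. u y t) x)"
    proof (rule add_mono)
      show "S * f (\<Phi> t) \<le> (\<Sum>\<^sub>\<infinity>x. ?w x * f (u x t))"
        using Jensen_weighted_infsum[OF f(1,2) f_nonneg w, of "\<lambda>x. u x t" B] S Bt
        by (simp add: \<Phi>_def)
    qed (rule gaussian_laplacian_ge[OF k Bt])
    also have "\<dots> = (\<Sum>\<^sub>\<infinity>x. ?w x * f (u x t) + ?w x * lattice_laplacian (\<lambda>y. u y t) x)"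
    proof (rule infsum_add[symmetric])
      show "(\<lambda>x. ?w x * f (u x t)) summable_on UNIV"
        using fB t by (intro summable_on_mult_bounded[OF w, where B="f B"]) auto
      show "(\<lambda>x. ?w x * lattice_laplacian (\<lambda>y. u y t) x) summable_on UNIV"
        using B t
        by (intro summable_on_mult_bounded[OF w, where B="2 * B"] abs_lattice_laplacian_le) auto
    qed
    also have "\<dots> = S * \<Phi>' t"
      using S(1) by (simp add: \<Phi>'_def u'_def algebra_simps)
    finally show "f (\<Phi> t) - (1 - exp (- k)) * \<Phi> t \<le> \<Phi>' t"
      using S(1) by simp
  next
    have "\<Phi> 0 = a"
      using sol by (simp add: \<Phi>_def a_def S_def is_solution_def)
    then show "0 < \<Phi> 0" "(1 - exp (- k)) * \<Phi> 0 < f (\<Phi> 0)"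
      using a by auto
  qed (use k in auto)
qed

text \<open>
  For a maximal solution, failing to be global already means that the norm explodes at a finite time.
\<close>

lemma blow_up_of_large_gaussian_mean:
  fixes u0 :: "int ^ 'n \<Rightarrow> real" and u :: "int ^ 'n \<Rightarrow> real \<Rightarrow> real"
  assumes f: "convex_on {0..} f" "f 0 = 0" "\<And>v. 0 < v \<Longrightarrow> 0 < f v"
    and int: "(\<integral>\<^sup>+v\<in>{1..}. ennreal (1 / f v) \<partial>lborel) < \<infinity>"
    and k: "0 < k" and u0: "\<And>x. 0 \<le> u0 x"
    and sol: "is_maximal_solution f u0 T u"
    and a_def: "a = (\<Sum>\<^sub>\<infinity>x. gaussian k x * u0 x) / theta (k / pi) ^ CARD('n)"
    and a: "0 < a" "(1 - exp (- k)) * a < f a"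
  shows "blows_up_in_finite_time T u"
proof -
  have "T \<noteq> \<infinity>"
    using no_global_solution[OF f int k u0 _ a_def a] sol by (auto simp: is_maximal_solution_def)
  then have T: "T < \<infinity>" "norm_explodes T u" and s: "is_solution f u0 T u"
    using sol by (auto simp: is_maximal_solution_def)
  have "(\<lambda>x. u x t) \<in> linf" if "0 < t" "ereal t < T" for t
  proof -
    have "bounded {u x s | x s. 0 \<le> s \<and> s \<le> t}"
      using s that by (auto simp: is_solution_def)
    then have "bounded (range (\<lambda>x. u x t))"
      by (rule bounded_subset) (use that in \<open>auto intro!: exI[of _ t]\<close>)
    then show ?thesis
      by (simp add: linf_def)
  qed
  then show ?thesis
    using T s by (auto simp: blows_up_in_finite_time_def is_solution_def)
qed

section \<open>The threshold\<close>

text \<open>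
  By monotonicity of \<open>f v / v\<close>, the condition \<open>f v / v > l\<close> propagates from a point below \<open>a\<close> to \<open>a\<close>.
  Superlinear growth makes the set in the definition of \<^const>\<open>s0\<close> nonempty; the infimum of the
  empty set would be unspecified.
\<close>

lemma above_s0:
  fixes f :: "real \<Rightarrow> real"
  assumes f: "convex_on {0..} f" "f 0 = 0" and lim: "filterlim (\<lambda>v. f v / v) at_top at_top"
    and a: "s0 f l < a"
  shows "0 < a" "l * a < f a"
proof -
  let ?A = "{v. 0 < v \<and> f v / v > l}"
  have "\<forall>\<^sub>F v in at_top. f v / v > l \<and> v > 0"
    using lim by (intro eventually_conj eventually_gt_at_top) (simp add: filterlim_at_top_dense)
  then have "?A \<noteq> {}"
    using eventually_happens trivial_limit_at_top_linorder by blast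
  then obtain v where v: "v \<in> ?A" "v < a"
    using a cInf_lessD[of ?A a] by (auto simp: s0_def)
  then show "0 < a" by auto
  have "f v / v \<le> f a / a"
    using v f by (intro convex_through_zero_ratio_mono) auto
  then have "l < f a / a"
    using v by auto
  with \<open>0 < a\<close> show "l * a < f a"
    by (simp add: field_simps)
qed

section \<open>The power reaction\<close>

text \<open>
  Only the boundary point \<open>0\<close> has to be added to \<open>powr_convex\<close>; if one argument is \<open>0\<close>, convexity
  amounts to \<open>s powr p \<le> s\<close> for \<open>0 \<le> s \<le> 1\<close>.
\<close>

lemma convex_on_powr_nonneg:
  fixes p :: real
  assumes "1 \<le> p"
  shows "convex_on {0..} (\<lambda>v. v powr p)"
proof -
  have scale: "(s * y) powr p \<le> s * y powr p" if "0 \<le> s" "s \<le> 1" "0 \<le> y" for s y :: real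
  proof -
    have "s powr p \<le> s"
      using that assms powr_mono'[of 1 p s] by simp
    then show ?thesis
      using that by (simp add: powr_mult mult_right_mono)
  qed
  show ?thesis
    unfolding convex_on_def
  proof (intro conjI ballI allI impI)
    fix x y s t :: real
    assume *: "x \<in> {0..}" "y \<in> {0..}" "0 \<le> s" "0 \<le> t" "s + t = 1"
    show "(s *\<^sub>R x + t *\<^sub>R y) powr p \<le> s * x powr p + t * y powr p"
    proof (cases "x = 0 \<or> y = 0")
      case True
      then show ?thesis
        using scale[of s x] scale[of t y] * assms by auto
    next
      case False
      then show ?thesis
        using * powr_convex[OF assms] by (auto simp: convex_on_def)
    qed
  qed simp
qed

lemma nn_integral_inverse_powr_finite:
  fixes p :: real
  assumes "1 < p"
  shows "(\<integral>\<^sup>+v\<in>{1..}. ennreal (1 / v powr p) \<partial>lborel) < \<infinity>"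
proof -
  have "(\<integral>\<^sup>+v. ennreal (1 / v powr p) * indicator {1..} v \<partial>lborel) = ennreal (0 - 1 powr (1 - p) / (1 - p))"
  proof (rule nn_integral_FTC_atLeast[where F="\<lambda>v. v powr (1 - p) / (1 - p)"])
    fix x :: real
    assume "1 \<le> x"
    then have "((\<lambda>v. v powr (1 - p)) has_real_derivative (1 - p) * x powr (1 - p - 1)) (at x)"
      by (intro has_real_derivative_powr) auto
    from DERIV_cdivide[OF this, of "1 - p"]
    show "((\<lambda>v. v powr (1 - p) / (1 - p)) has_real_derivative 1 / x powr p) (at x)"
      using assms by (simp add: powr_minus_divide)
  next
    show "((\<lambda>v. v powr (1 - p) / (1 - p)) \<longlongrightarrow> 0) at_top"
      using tendsto_divide[OF tendsto_neg_powr[OF _ filterlim_ident] tendsto_const, of "1 - p" "1 - p"] assms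
      by simp
  qed auto
  then show ?thesis
    by simp
qed

section \<open>The blow-up theorem\<close>

lemma weighted_initial_sum:
  fixes u0 :: "int ^ 'n \<Rightarrow> real"
  shows "(\<Sum>\<^sub>\<infinity>x. exp (- k * (euclid_norm x)\<^sup>2) * u0 x * node_measure x)
    = (\<Sum>\<^sub>\<infinity>x. gaussian k x * u0 x) * (2 * real CARD('n))"
  unfolding node_measure_def gaussian_def by (rule infsum_cmult_left')

theorem theorem4p7:
  fixes u0 :: "int ^ 'n \<Rightarrow> real"
    and u :: "int ^ 'n \<Rightarrow> real \<Rightarrow> real"
    and T :: ereal
  assumes u0_nonneg: "\<forall>x. 0 \<le> u0 x"
    and u0_bounded: "u0 \<in> linf"
    and u0_nonzero: "\<exists>x. u0 x \<noteq> 0"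
  shows "(\<forall>f k l.
            admissible_reaction f \<and> is_maximal_solution f u0 T u \<and>
            0 < k \<and> 1 - exp (- k) \<le> l \<and>
            1 / (2 * real CARD('n)) * (theta (k / pi)) powi (- int CARD('n)) *
              (\<Sum>\<^sub>\<infinity>x. exp (- k * (euclid_norm x)\<^sup>2) * u0 x * node_measure x) > s0 f l
            \<longrightarrow> blows_up_in_finite_time T u) \<and>
         (\<forall>p k.
            1 < p \<and> is_maximal_solution (\<lambda>v. v powr p) u0 T u \<and>
            0 < k \<and>
            (\<Sum>\<^sub>\<infinity>x. exp (- k * (euclid_norm x)\<^sup>2) * u0 x * node_measure x) >
              (2 * real CARD('n)) powr (p / (p - 1)) * theta (k / pi) ^ CARD('n) *
                k powr (1 / (p - 1))
            \<longrightarrow> blows_up_in_finite_time T u)"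
proof (intro conjI allI impI; elim conjE)
  fix f :: "real \<Rightarrow> real" and k l :: real
  assume f: "admissible_reaction f" and sol: "is_maximal_solution f u0 T u"
    and k: "0 < k" and l: "1 - exp (- k) \<le> l"
    and large: "s0 f l < 1 / (2 * real CARD('n)) * (theta (k / pi)) powi (- int CARD('n)) *
      (\<Sum>\<^sub>\<infinity>x. exp (- k * (euclid_norm x)\<^sup>2) * u0 x * node_measure x)"
  define a where "a = (\<Sum>\<^sub>\<infinity>x. gaussian k x * u0 x) / theta (k / pi) ^ CARD('n)"
  have "s0 f l < a"
    using large unfolding weighted_initial_sum
    by (simp add: a_def power_int_minus field_simps)
  then have a: "0 < a" "l * a < f a"
    using f above_s0[of f l a] by (auto simp: admissible_reaction_def)
  have "(1 - exp (- k)) * a \<le> l * a"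
    using l a(1) by (intro mult_right_mono) auto
  with a have "(1 - exp (- k)) * a < f a"
    by linarith
  with a(1) show "blows_up_in_finite_time T u"
    using f k sol u0_nonneg
    by (intro blow_up_of_large_gaussian_mean[OF _ _ _ _ _ _ _ a_def])
      (auto simp: admissible_reaction_def)
next
  fix p k :: real
  assume p: "1 < p" and sol: "is_maximal_solution (\<lambda>v. v powr p) u0 T u" and k: "0 < k"
    and large: "(2 * real CARD('n)) powr (p / (p - 1)) * theta (k / pi) ^ CARD('n) *
        k powr (1 / (p - 1))
      < (\<Sum>\<^sub>\<infinity>x. exp (- k * (euclid_norm x)\<^sup>2) * u0 x * node_measure x)"
  define J where "J = (\<Sum>\<^sub>\<infinity>x. gaussian k x * u0 x)"
  define S where "S = theta (k / pi) ^ CARD('n)"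
  define a where "a = J / S"
  define c where "c = k powr (1 / (p - 1))"
  have S: "0 < S"
    using theta_pos[OF k] by (simp add: S_def)
  have c: "0 < c" "c powr (p - 1) = k"
    using k p by (simp_all add: c_def powr_powr)
  have "(2 * real CARD('n)) powr 1 \<le> (2 * real CARD('n)) powr (p / (p - 1))"
  proof (rule powr_mono)
    have "0 < CARD('n)"
      by simp
    then show "1 \<le> 2 * real CARD('n)"
      by linarith
  qed (use p in \<open>simp add: field_simps\<close>)
  then have "2 * real CARD('n) * (S * c) \<le> (2 * real CARD('n)) powr (p / (p - 1)) * (S * c)"
    using S c(1) by (intro mult_right_mono) auto
  also have "\<dots> < 2 * real CARD('n) * J"
    using large unfolding weighted_initial_sum J_def S_def c_def by (simp add: mult_ac)
  finally have "S * c < J"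
    by simp
  then have ca: "c < a"
    using S by (simp add: a_def field_simps)
  then have a: "0 < a"
    using c(1) by linarith
  have "1 - exp (- k) \<le> k"
    using exp_ge_add_one_self[of "- k"] by linarith
  also have "k < a powr (p - 1)"
    using powr_less_mono2[of "p - 1" c a] p c ca by simp
  finally have "(1 - exp (- k)) * a < a powr (p - 1) * a"
    using a by simp
  also have "\<dots> = a powr p"
    using a by (simp add: powr_diff)
  finally show "blows_up_in_finite_time T u"
    using a p
    by (intro blow_up_of_large_gaussian_mean[OF convex_on_powr_nonneg _ _
          nn_integral_inverse_powr_finite k _ sol a_def[unfolded J_def S_def]])
      (use u0_nonneg in auto)
qed

end
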